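(* Let $G$ be a simple connected graph of order $n$ and minimum degree $\delta\geq k\geq 2$, and let $q_0=q(K_{k-1}\vee(K_{\delta-k+2}\cup K_{n-\delta-1}))$. Suppose that $q(G)\geq q_0$. Then $G$ is $k$-connected if and only if $G\not\cong K_{k-1}\vee(K_{\delta-k+2}\cup K_{n-\delta-1})$.
   Context: $q(H)$ denotes the $Q$-index of a graph $H$, the largest eigenvalue of $D(H)+A(H)$ ($D$ = diagonal degree matrix, $A$ = adjacency matrix). $G\vee H$ is the join (disjoint union plus all edges between $G$ and $H$), $G\cup H$ the disjoint union, $K_r$ the complete graph on $r$ vertices. A vertex subset $C$ of a connected graph $G$ is a vertex-cut if $G-C$ is disconnected or $G-C=K_1$; $\kappa(G)$ is the minimum size of a vertex-cut. $G$ is $k$-connected if $\kappa(G)\geq k$.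
   Formalization: The formal theorem assumes n-δ-1 ≥ 1, excluding only G = K_n (n = δ+1): there K_{n-δ-1} would be K_0, the comparison graph would be K_n itself, and since K_n is k-connected the stated equivalence would fail (e.g. K_3 with k = 2). *)

theory Defs
  imports
    "Graph_Theory.Graph_Theory"
    "Jordan_Normal_Form.Spectral_Radius"
begin

text \<open>
  A finite simple graph is a \<^locale>\<open>pair_graph\<close>: a finite, loop-free, symmetric set of arcs,
  where both \<open>(u, v)\<close> and \<open>(v, u)\<close> represent the edge \<open>uv\<close>. Hence \<^const>\<open>out_degree\<close> is the degree.
\<close>

definition min_degree :: "'a pair_pre_digraph \<Rightarrow> nat" where
  "min_degree G = Min (out_degree (with_proj G) ` pverts G)"

definition complete_graph :: "nat \<Rightarrow> nat pair_pre_digraph" where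
  "complete_graph r =
    \<lparr>pverts = {0..<r}, parcs = {(u, v). u \<in> {0..<r} \<and> v \<in> {0..<r} \<and> u \<noteq> v}\<rparr>"

definition graph_union ::
    "'a pair_pre_digraph \<Rightarrow> 'b pair_pre_digraph \<Rightarrow> ('a + 'b) pair_pre_digraph" where
  "graph_union G H =
    \<lparr>pverts = pverts G <+> pverts H,
     parcs = map_prod Inl Inl ` parcs G \<union> map_prod Inr Inr ` parcs H\<rparr>"

definition graph_join ::
    "'a pair_pre_digraph \<Rightarrow> 'b pair_pre_digraph \<Rightarrow> ('a + 'b) pair_pre_digraph" where
  "graph_join G H =
    \<lparr>pverts = pverts G <+> pverts H,
     parcs = parcs (graph_union G H)
       \<union> (Inl ` pverts G) \<times> (Inr ` pverts H) \<union> (Inr ` pverts H) \<times> (Inl ` pverts G)\<rparr>"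

text \<open>Matrices of a graph are taken with respect to an enumeration \<open>vs\<close> of its vertices.\<close>

definition adjacency_mat :: "'a pair_pre_digraph \<Rightarrow> 'a list \<Rightarrow> real mat" where
  "adjacency_mat G vs =
    mat (length vs) (length vs) (\<lambda>(i, j). if (vs ! i, vs ! j) \<in> parcs G then 1 else 0)"

definition degree_mat :: "'a pair_pre_digraph \<Rightarrow> 'a list \<Rightarrow> real mat" where
  "degree_mat G vs =
    mat (length vs) (length vs)
      (\<lambda>(i, j). if i = j then real (out_degree (with_proj G) (vs ! i)) else 0)"

text \<open>
  The choice of the enumeration is immaterial: another one conjugates the matrix by a permutation
  matrix. The matrix is real symmetric, so its real spectrum contains all of its eigenvalues.
\<close>

definition Q_index :: "'a pair_pre_digraph \<Rightarrow> real" where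
  "Q_index G =
    (let vs = (SOME vs. distinct vs \<and> set vs = pverts G)
     in Max (spectrum (degree_mat G vs + adjacency_mat G vs)))"

text \<open>
  \<^term>\<open>Digraph_Component.connected\<close> is false for the graph without vertices, so the inclusion is
  strict in order not to count the full vertex set as a vertex-cut.
\<close>

definition vertex_cut :: "'a pair_pre_digraph \<Rightarrow> 'a set \<Rightarrow> bool" where
  "vertex_cut G C \<longleftrightarrow> C \<subset> pverts G \<and>
    (let H = induce_subgraph (with_proj G) (pverts G - C)
     in \<not> Digraph_Component.connected H \<or> complete_digraph 1 H)"

definition vertex_connectivity :: "'a pair_pre_digraph \<Rightarrow> nat" where
  "vertex_connectivity G = Min (card ` {C. vertex_cut G C})"

definition k_connected :: "nat \<Rightarrow> 'a pair_pre_digraph \<Rightarrow> bool" where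
  "k_connected k G \<longleftrightarrow> k \<le> vertex_connectivity G"

lemma complete_digraph_complete_graph: "complete_digraph r (with_proj (complete_graph r))"
  by (auto simp: complete_digraph_pair_def complete_graph_def)

lemma pair_graph_complete_graph: "pair_graph (complete_graph r)"
  by (rule pair_graphI_complete[OF complete_digraph_complete_graph])

lemma pair_graph_graph_union:
  assumes "pair_graph G" "pair_graph H"
  shows "pair_graph (graph_union G H)"
proof -
  interpret G: pair_graph G by fact
  interpret H: pair_graph H by fact
  show ?thesis
  proof
    show "symmetric (with_proj (graph_union G H))"
      by (auto simp: graph_union_def symmetric_def intro!: symI dest: G.arcs_symmetric H.arcs_symmetric)
  qed (auto simp: graph_union_def G.pair_finite_verts H.pair_finite_verts
      G.pair_finite_arcs H.pair_finite_arcs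
      dest: G.in_arcsD1 G.in_arcsD2 H.in_arcsD1 H.in_arcsD2 G.no_loops' H.no_loops')
qed

lemma pair_graph_graph_join:
  assumes "pair_graph G" "pair_graph H"
  shows "pair_graph (graph_join G H)"
proof -
  interpret G: pair_graph G by fact
  interpret H: pair_graph H by fact
  show ?thesis
  proof
    show "symmetric (with_proj (graph_join G H))"
      by (auto simp: graph_join_def graph_union_def symmetric_def intro!: symI
          dest: G.arcs_symmetric H.arcs_symmetric)
  qed (auto simp: graph_join_def graph_union_def G.pair_finite_verts H.pair_finite_verts
      G.pair_finite_arcs H.pair_finite_arcs
      dest: G.in_arcsD1 G.in_arcsD2 H.in_arcsD1 H.in_arcsD2 G.no_loops' H.no_loops')
qed

end

theory Submission
  imports Defs "HOL-Analysis.Function_Topology"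
begin

text \<open>
  The \<open>Q\<close>-index is the maximum of the quadratic form \<open>\<Sum> (x u + x v)\<^sup>2\<close>, summed over the edges
  \<open>uv\<close>, on the unit sphere; for a connected graph it is attained at a positive function \<open>x\<close>. If \<open>G\<close>
  is not \<open>k\<close>-connected, its vertices split into \<open>C\<close>, \<open>A\<close>, \<open>B\<close> with \<open>|C| = k - 1\<close>,
  \<open>m := \<delta> - k + 2 \<le> |A| \<le> |B|\<close> and no edges between \<open>A\<close> and \<open>B\<close>. Adding all other missing edges can
  only increase the form at \<open>x\<close>. If \<open>|A| > m\<close>, replace \<open>A\<close> by the \<open>m\<close> vertices of \<open>A \<union> B\<close> with the
  smallest values of \<open>x\<close>, and \<open>B\<close> by the rest: this strictly decreases the weight of the edges missing
  between the two sides. So the form at \<open>x\<close> is strictly smaller for \<open>G\<close> than for a copy of the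
  extremal graph, unless \<open>G\<close> is that copy.
\<close>

subsection \<open>The quadratic form of the signless Laplacian\<close>

text \<open>The quadratic form of \<open>D + A\<close>. Both arcs of every edge lie in
  \<open>parcs G\<close>, hence the division by 2.\<close>

definition signless_form :: "'a pair_pre_digraph \<Rightarrow> ('a \<Rightarrow> real) \<Rightarrow> real" where
  "signless_form G x = (\<Sum>(u, v)\<in>parcs G. (x u + x v)\<^sup>2) / 2"

text \<open>The entry of \<open>(D + A) x\<close> at \<open>u\<close>: summing \<open>x u\<close>
  once per neighbour supplies the degree.\<close>

definition signless_op :: "'a pair_pre_digraph \<Rightarrow> ('a \<Rightarrow> real) \<Rightarrow> 'a \<Rightarrow> real" where
  "signless_op G x u = (\<Sum>v | (u, v) \<in> parcs G. x u + x v)"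

lemma signless_form_scale: "signless_form G (\<lambda>v. c * x v) = c\<^sup>2 * signless_form G x"
proof -
  have "(c * a + c * b)\<^sup>2 = c\<^sup>2 * (a + b)\<^sup>2" for a b :: real
    by (simp add: power_mult_distrib flip: distrib_left)
  then show ?thesis
    by (simp add: signless_form_def sum_distrib_left case_prod_unfold)
qed

text \<open>Follows from the triangle inequality; it lets a maximiser be sought among nonnegative
  functions.\<close>

lemma signless_form_le_abs: "signless_form G x \<le> signless_form G (\<lambda>v. \<bar>x v\<bar>)"
proof -
  have "(a + b)\<^sup>2 \<le> (\<bar>a\<bar> + \<bar>b\<bar>)\<^sup>2" for a b :: real
    by (rule power2_le_iff_abs_le[THEN iffD2]) auto
  then show ?thesis
    unfolding signless_form_def by (intro divide_right_mono sum_mono) auto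
qed

lemma (in pair_wf_digraph) signless_form_cong:
  assumes "\<And>v. v \<in> pverts G \<Longrightarrow> x v = y v"
  shows "signless_form G x = signless_form G y"
proof -
  have "(x u + x v)\<^sup>2 = (y u + y v)\<^sup>2" if "(u, v) \<in> parcs G" for u v
    using that assms by (simp add: in_arcsD1 in_arcsD2)
  then show ?thesis
    unfolding signless_form_def by (auto intro!: arg_cong[where f = "\<lambda>s. s / 2"] sum.cong)
qed

context pair_graph
begin

lemma arcs_eq_Sigma: "parcs G = Sigma (pverts G) (\<lambda>u. {v. (u, v) \<in> parcs G})"
  using in_arcsD1 by auto

lemma finite_nbrs [simp]: "finite {v. (u, v) \<in> parcs G}"
  by (rule finite_subset[OF _ pair_finite_verts]) (auto dest: in_arcsD2)

lemma sum_arcs: "(\<Sum>(u, v)\<in>parcs G. f u v) = (\<Sum>u\<in>pverts G. \<Sum>v | (u, v) \<in> parcs G. f u v)"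
  by (subst arcs_eq_Sigma, subst sum.Sigma) (auto simp: pair_finite_verts)

lemma sum_arcs_swap: "(\<Sum>(u, v)\<in>parcs G. f u v) = (\<Sum>(u, v)\<in>parcs G. f v u)"
  by (rule sum.reindex_bij_witness[of _ prod.swap prod.swap]) (auto intro: arcs_symmetric)

text \<open>A discrete Green formula: symmetry of the arcs makes the parts with \<open>z u\<close>
  and with \<open>z v\<close> equal, so the bilinear form is the inner product of \<open>z\<close>
  with \<open>(D + A) x\<close>.\<close>

lemma signless_green:
  "(\<Sum>(u, v)\<in>parcs G. (x u + x v) * (z u + z v)) / 2 = (\<Sum>u\<in>pverts G. z u * signless_op G x u)"
proof -
  have "(\<Sum>(u, v)\<in>parcs G. (x u + x v) * (z u + z v))
      = (\<Sum>(u, v)\<in>parcs G. (x u + x v) * z u) + (\<Sum>(u, v)\<in>parcs G. (x u + x v) * z v)"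
    by (simp add: distrib_left case_prod_unfold sum.distrib)
  also have "(\<Sum>(u, v)\<in>parcs G. (x u + x v) * z v) = (\<Sum>(u, v)\<in>parcs G. (x u + x v) * z u)"
    by (subst sum_arcs_swap) (simp add: add.commute)
  also have "(\<Sum>(u, v)\<in>parcs G. (x u + x v) * z u) = (\<Sum>u\<in>pverts G. z u * signless_op G x u)"
    by (subst sum_arcs) (simp only: signless_op_def sum_distrib_left mult.commute)
  finally show ?thesis by simp
qed

lemma signless_form_eq_op: "signless_form G x = (\<Sum>u\<in>pverts G. x u * signless_op G x u)"
  using signless_green[of x x] by (simp add: signless_form_def power2_eq_square)

text \<open>A continuous function attains its maximum on the compact nonnegative part of the unit
  sphere; absolute values and scaling carry the bound to every \<open>y\<close>.\<close>

lemma signless_form_attains_max: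
  assumes "pverts G \<noteq> {}"
  obtains x where "\<And>v. 0 \<le> x v" and "(\<Sum>v\<in>pverts G. (x v)\<^sup>2) = 1"
    and "\<And>y. signless_form G y \<le> signless_form G x * (\<Sum>v\<in>pverts G. (y v)\<^sup>2)"
proof -
  \<comment> \<open>Functions live on the whole type, so coordinates off the vertices are pinned to
    0. As a product of compact sets, \<open>B\<close> is compact by Tychonoff's theorem.\<close>
  define B where "B = PiE UNIV (\<lambda>v. if v \<in> pverts G then {0..1::real} else {0})"
  define K where "K = B \<inter> {x. (\<Sum>v\<in>pverts G. (x v)\<^sup>2) = 1}"
  have coord [continuous_intros]: "continuous_on UNIV (\<lambda>x::'a \<Rightarrow> real. x v)" for v
    by (rule continuous_on_product_coordinates)
  have "compactin (product_topology (\<lambda>_. euclidean) UNIV) B"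
    unfolding B_def by (subst compactin_PiE) auto
  then have "compact B"
    by (simp only: euclidean_product_topology compactin_euclidean_iff)
  moreover have "closed {x :: 'a \<Rightarrow> real. (\<Sum>v\<in>pverts G. (x v)\<^sup>2) = 1}"
    by (intro closed_Collect_eq continuous_intros)
  ultimately have "compact K"
    unfolding K_def by (rule compact_Int_closed)
  obtain w where w: "w \<in> pverts G"
    using assms by auto
  have "(\<lambda>v. if v = w then 1 else 0) \<in> K"
    using w pair_finite_verts by (auto simp: K_def B_def if_distrib[where f = "\<lambda>t. t\<^sup>2"] cong: if_cong)
  then have "K \<noteq> {}" by auto
  have "continuous_on UNIV (signless_form G)"
    unfolding signless_form_def case_prod_unfold by (intro continuous_intros) auto
  then have "continuous_on K (signless_form G)"
    by (rule continuous_on_subset) auto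
  then obtain x where x: "x \<in> K" and max: "\<And>y. y \<in> K \<Longrightarrow> signless_form G y \<le> signless_form G x"
    using continuous_attains_sup[OF \<open>compact K\<close> \<open>K \<noteq> {}\<close>] by metis
  show thesis
  proof
    show "0 \<le> x v" for v
      using x by (auto simp: K_def B_def PiE_iff split: if_splits dest!: spec[of _ v])
    show "(\<Sum>v\<in>pverts G. (x v)\<^sup>2) = 1"
      using x by (simp add: K_def)
    fix y :: "'a \<Rightarrow> real"
    define s where "s = (\<Sum>v\<in>pverts G. (y v)\<^sup>2)"
    show "signless_form G y \<le> signless_form G x * (\<Sum>v\<in>pverts G. (y v)\<^sup>2)"
    proof (cases "s = 0")
      case True
      then have "y v = 0" if "v \<in> pverts G" for v
        using that by (simp add: s_def sum_nonneg_eq_0_iff pair_finite_verts)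
      then have "signless_form G y = signless_form G (\<lambda>v. 0 * y v)"
        by (intro signless_form_cong) simp
      then show ?thesis
        using True unfolding signless_form_scale s_def by simp
    next
      case False
      then have "s > 0"
        using sum_nonneg[of "pverts G" "\<lambda>v. (y v)\<^sup>2"] by (simp add: s_def)
      define z where "z v = (if v \<in> pverts G then \<bar>y v\<bar> / sqrt s else 0)" for v
      have norm: "(\<Sum>v\<in>pverts G. (z v)\<^sup>2) = 1"
        using \<open>s > 0\<close> by (simp add: z_def power_divide s_def flip: sum_divide_distrib)
      have "z v \<le> 1" if "v \<in> pverts G" for v
      proof -
        have "(z v)\<^sup>2 \<le> 1"
          using member_le_sum[OF that, of "\<lambda>v. (z v)\<^sup>2"] norm pair_finite_verts by simp
        then show ?thesis
          by (simp add: abs_square_le_1)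
      qed
      then have "z \<in> K"
        using \<open>s > 0\<close> norm by (auto simp: K_def B_def z_def)
      have "signless_form G y \<le> signless_form G (\<lambda>v. \<bar>y v\<bar>)"
        by (rule signless_form_le_abs)
      also have "\<dots> = signless_form G (\<lambda>v. sqrt s * z v)"
        using \<open>s > 0\<close> by (intro signless_form_cong) (simp add: z_def)
      also have "\<dots> = s * signless_form G z"
        using \<open>s > 0\<close> by (simp add: signless_form_scale)
      also have "\<dots> \<le> s * signless_form G x"
        using max[OF \<open>z \<in> K\<close>] \<open>s > 0\<close> by simp
      finally show ?thesis
        by (simp add: s_def mult.commute)
    qed
  qed
qed

text \<open>First-order condition: perturb the maximiser by \<open>t\<close> times the indicator of \<open>w\<close>.\<close>

lemma signless_op_maximizer:
  assumes max: "\<And>y. signless_form G y \<le> r * (\<Sum>v\<in>pverts G. (y v)\<^sup>2)"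
    and eq: "signless_form G x = r * (\<Sum>v\<in>pverts G. (x v)\<^sup>2)"
    and w: "w \<in> pverts G"
  shows "signless_op G x w = r * x w"
proof -
  define z :: "'a \<Rightarrow> real" where "z v = (if v = w then 1 else 0)" for v
  \<comment> \<open>By \<open>eq\<close>, the gap between \<open>r\<close> times the squared norm
    and the form at \<open>x + t z\<close> is \<open>2 * t * d + t\<^sup>2 * c\<close>. It is never
    negative, which forces \<open>d = 0\<close>.\<close>
  define d where "d = r * x w - signless_op G x w"
  define c where "c = r - signless_form G z"
  have form: "signless_form G (\<lambda>v. x v + t * z v)
      = signless_form G x + 2 * t * signless_op G x w + t\<^sup>2 * signless_form G z" for t
  proof -
    have "((x u + t * z u) + (x v + t * z v))\<^sup>2
        = (x u + x v)\<^sup>2 + 2 * t * ((x u + x v) * (z u + z v)) + t\<^sup>2 * (z u + z v)\<^sup>2" for u v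
      by (simp add: power2_eq_square algebra_simps)
    then have "signless_form G (\<lambda>v. x v + t * z v) = signless_form G x
        + 2 * t * ((\<Sum>(u, v)\<in>parcs G. (x u + x v) * (z u + z v)) / 2) + t\<^sup>2 * signless_form G z"
      by (simp add: signless_form_def case_prod_unfold sum.distrib sum_distrib_left add_divide_distrib)
    also have "(\<Sum>(u, v)\<in>parcs G. (x u + x v) * (z u + z v)) / 2 = signless_op G x w"
      unfolding signless_green using w pair_finite_verts by (simp add: z_def if_distrib[where f = "\<lambda>t. t * _"] cong: if_cong)
    finally show ?thesis .
  qed
  have norm: "(\<Sum>v\<in>pverts G. (x v + t * z v)\<^sup>2) = (\<Sum>v\<in>pverts G. (x v)\<^sup>2) + 2 * t * x w + t\<^sup>2" for t
  proof -
    have "(x v + t * z v)\<^sup>2 = (x v)\<^sup>2 + (if v = w then 2 * t * x w + t\<^sup>2 else 0)" for v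
      by (simp add: z_def power2_eq_square algebra_simps)
    then show ?thesis
      using w pair_finite_verts by (simp add: sum.distrib)
  qed
  have quad: "0 \<le> 2 * t * d + t\<^sup>2 * c" for t
    using max[of "\<lambda>v. x v + t * z v"] eq
    unfolding form norm d_def c_def by (simp add: algebra_simps)
  have "d = 0"
  proof (rule ccontr)
    assume "d \<noteq> 0"
    \<comment> \<open>At \<open>t = - d / s\<close> the gap is
      \<open>d\<^sup>2 * (c - 2 * s) / s\<^sup>2\<close>, negative as soon as
      \<open>c < 2 * s\<close>.\<close>
    obtain s where s: "s > 0" "c < 2 * s"
      by (rule that[of "\<bar>c\<bar> + 1"]) auto
    have "0 \<le> (2 * (- d / s) * d + (- d / s)\<^sup>2 * c) * s\<^sup>2"
      by (rule mult_nonneg_nonneg[OF quad]) simp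
    also have "\<dots> = d\<^sup>2 * (c - 2 * s)"
      using s(1) by (simp add: field_simps power2_eq_square)
    also have "\<dots> < 0"
      using \<open>d \<noteq> 0\<close> s(2) by (intro mult_pos_neg) auto
    finally show False by simp
  qed
  then show ?thesis by (simp add: d_def)
qed

text \<open>Zeros spread: where \<open>x\<close> vanishes, the eigenvalue equation makes a sum of
  nonnegative neighbour values 0, so all neighbours are zeros, and connectedness carries this to
  every vertex.\<close>

lemma pos_if_eigenfunction:
  assumes conn: "Digraph_Component.connected (with_proj G)"
    and nonneg: "\<And>v. 0 \<le> x v" and nz: "(\<Sum>v\<in>pverts G. (x v)\<^sup>2) \<noteq> 0"
    and eig: "\<And>u. u \<in> pverts G \<Longrightarrow> signless_op G x u = r * x u"
    and w: "w \<in> pverts G"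
  shows "0 < x w"
proof (rule ccontr)
  assume "\<not> 0 < x w"
  then have "x w = 0" using nonneg[of w] by simp
  have "strongly_connected (with_proj G)"
    using conn sym_arcs by (rule symmetric_connected_imp_strongly_connected[rotated])
  then have reach: "w \<rightarrow>\<^sup>*\<^bsub>with_proj G\<^esub> v" if "v \<in> pverts G" for v
    using that w by (auto simp: strongly_connected_def)
  have "x v = 0" if "v \<in> pverts G" for v
    using reach[OF that]
  proof (induction rule: reachable_induct)
    case base
    show ?case by fact
  next
    case (step u v)
    then have "(u, v) \<in> parcs G" "u \<in> pverts G"
      by (auto dest: in_arcsD1)
    then have "(\<Sum>v | (u, v) \<in> parcs G. x v) = 0"
      using eig[of u] step by (simp add: signless_op_def)
    then show ?case
      using \<open>(u, v) \<in> parcs G\<close> nonneg by (simp add: sum_nonneg_eq_0_iff)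
  qed
  then show False using nz by simp
qed

subsection \<open>The \<open>Q\<close>-index and the Perron function\<close>

lemma out_degree_eq_card_nbrs: "out_degree (with_proj G) u = card {v. (u, v) \<in> parcs G}"
proof -
  have "out_arcs (with_proj G) u = Pair u ` {v. (u, v) \<in> parcs G}"
    by (auto simp: out_arcs_def)
  then show ?thesis
    by (simp add: out_degree_def card_image inj_on_def)
qed

lemma signless_matrix_mult:
  assumes vs: "distinct vs" "set vs = pverts G" and i: "i < length vs"
    and v: "v = vec (length vs) (\<lambda>i. x (vs ! i))"
  shows "((degree_mat G vs + adjacency_mat G vs) *\<^sub>v v) $ i = signless_op G x (vs ! i)"
proof -
  let ?u = "vs ! i" and ?n = "length vs"
  have inj: "inj_on ((!) vs) {0..<?n}"
    using vs by (auto intro: inj_on_nth)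
  have img: "(!) vs ` {0..<?n} = pverts G"
    by (simp add: nth_image vs)
  let ?M = "degree_mat G vs + adjacency_mat G vs"
  have entry: "?M $$ (i, j) = (if i = j then real (out_degree (with_proj G) ?u) else 0)
      + (if (?u, vs ! j) \<in> parcs G then 1 else 0)" if "j < ?n" for j
    using i that by (simp add: degree_mat_def adjacency_mat_def)
  have "dim_row ?M = ?n" "dim_col ?M = ?n"
    by (simp_all add: adjacency_mat_def)
  then have "(?M *\<^sub>v v) $ i = (\<Sum>j = 0..<?n. ?M $$ (i, j) * x (vs ! j))"
    using i unfolding v by (simp add: scalar_prod_def del: index_add_mat)
  also have "\<dots> = (\<Sum>j = 0..<?n. (if i = j then real (out_degree (with_proj G) ?u) * x ?u else 0)
      + (if (?u, vs ! j) \<in> parcs G then x (vs ! j) else 0))"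
    by (intro sum.cong refl) (auto simp: entry distrib_right simp del: index_add_mat)
  also have "\<dots> = (\<Sum>j = 0..<?n. (if i = j then real (out_degree (with_proj G) ?u) * x ?u else 0))
      + (\<Sum>j = 0..<?n. (if (?u, vs ! j) \<in> parcs G then x (vs ! j) else 0))"
    by (rule sum.distrib)
  also have "(\<Sum>j = 0..<?n. (if i = j then real (out_degree (with_proj G) ?u) * x ?u else 0))
      = real (out_degree (with_proj G) ?u) * x ?u"
    using i by simp
  also have "(\<Sum>j = 0..<?n. (if (?u, vs ! j) \<in> parcs G then x (vs ! j) else 0))
      = (\<Sum>w\<in>pverts G. (if (?u, w) \<in> parcs G then x w else 0))"
    using sum.reindex[OF inj, of "\<lambda>w. if (?u, w) \<in> parcs G then x w else 0"] img by simp
  also have "\<dots> = (\<Sum>w | (?u, w) \<in> parcs G. x w)"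
    by (rule sum.mono_neutral_cong_right) (auto simp: pair_finite_verts dest: in_arcsD2)
  finally show ?thesis
    unfolding signless_op_def sum.distrib out_degree_eq_card_nbrs by simp
qed

text \<open>Translates eigenvectors into functions on the vertices. The right-hand side does not
  mention \<open>vs\<close>, so \<open>Q_index\<close> can be studied without matrices and
  enumerations.\<close>

lemma spectrum_signless:
  assumes vs: "distinct vs" "set vs = pverts G"
  shows "spectrum (degree_mat G vs + adjacency_mat G vs)
    = {r. \<exists>x. (\<exists>v\<in>pverts G. x v \<noteq> 0) \<and> (\<forall>u\<in>pverts G. signless_op G x u = r * x u)}"
    (is "spectrum ?M = ?R")
proof -
  let ?n = "length vs"
  have dim: "dim_row ?M = ?n" by (simp add: adjacency_mat_def)
  have vertsE: "(\<forall>u\<in>pverts G. P u) \<longleftrightarrow> (\<forall>i<?n. P (vs ! i))" for P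
    using vs by (metis in_set_conv_nth)
  have ev: "eigenvector ?M (vec ?n (\<lambda>i. x (vs ! i))) r \<longleftrightarrow>
      (\<exists>v\<in>pverts G. x v \<noteq> 0) \<and> (\<forall>u\<in>pverts G. signless_op G x u = r * x u)" for x r
  proof -
    let ?v = "vec ?n (\<lambda>i. x (vs ! i))"
    have "?v \<noteq> 0\<^sub>v ?n \<longleftrightarrow> (\<exists>v\<in>pverts G. x v \<noteq> 0)"
      using vertsE[of "\<lambda>v. x v = 0"] by (auto simp: vec_eq_iff)
    moreover have "?M *\<^sub>v ?v = r \<cdot>\<^sub>v ?v \<longleftrightarrow> (\<forall>u\<in>pverts G. signless_op G x u = r * x u)"
      unfolding vertsE vec_eq_iff
      using signless_matrix_mult[OF vs _ refl, of _ x] dim by auto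
    moreover have "?v \<in> carrier_vec ?n"
      by simp
    ultimately show ?thesis
      unfolding eigenvector_def dim by blast
  qed
  show ?thesis
  proof (intro equalityI subsetI)
    fix r assume "r \<in> spectrum ?M"
    then obtain v where v: "eigenvector ?M v r"
      by (auto simp: spectrum_def eigenvalue_def)
    \<comment> \<open>Reads the vector as a function on vertices by inverting the
      enumeration.\<close>
    define x where "x u = v $ (inv_into {0..<?n} ((!) vs) u)" for u
    have "inj_on ((!) vs) {0..<?n}"
      using vs by (auto intro: inj_on_nth)
    moreover have "dim_vec v = ?n"
      using v unfolding eigenvector_def dim carrier_vec_def by blast
    ultimately have "vec ?n (\<lambda>i. x (vs ! i)) = v"
      by (intro eq_vecI) (simp_all add: x_def inv_into_f_f)
    then have "eigenvector ?M (vec ?n (\<lambda>i. x (vs ! i))) r"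
      using v by (simp only:)
    then show "r \<in> ?R"
      unfolding ev by blast
  next
    fix r assume "r \<in> ?R"
    then show "r \<in> spectrum ?M"
      using ev by (auto simp: spectrum_def eigenvalue_def)
  qed
qed

text \<open>\<open>Max\<close> is informative only on a finite nonempty set. Finiteness is inherited
  from the spectrum of a square matrix; an element is supplied in
  \<open>Q_index_maximizer\<close>.\<close>

lemma Q_index_eq_Max:
  "Q_index G = Max {r. \<exists>x. (\<exists>v\<in>pverts G. x v \<noteq> 0) \<and> (\<forall>u\<in>pverts G. signless_op G x u = r * x u)}"
  (is "_ = Max ?S")
  and finite_signless_eigenvalues:
  "finite {r. \<exists>x. (\<exists>v\<in>pverts G. x v \<noteq> 0) \<and> (\<forall>u\<in>pverts G. signless_op G x u = r * x u)}"
proof -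
  define vs where "vs = (SOME vs. distinct vs \<and> set vs = pverts G)"
  have "\<exists>vs. distinct vs \<and> set vs = pverts G"
    using finite_distinct_list[OF pair_finite_verts] by auto
  from someI_ex[OF this] have vs: "distinct vs" "set vs = pverts G"
    unfolding vs_def by auto
  show "Q_index G = Max ?S"
    unfolding Q_index_def Let_def vs_def[symmetric] spectrum_signless[OF vs] ..
  have "degree_mat G vs + adjacency_mat G vs \<in> carrier_mat (length vs) (length vs)"
    by (auto simp: degree_mat_def adjacency_mat_def)
  from card_finite_spectrum(1)[OF this] show "finite ?S"
    unfolding spectrum_signless[OF vs] .
qed

text \<open>Rayleigh's principle. The maximal value is an eigenvalue by the first-order condition;
  an eigenvalue \<open>r\<close> with eigenfunction \<open>y\<close> is the form divided by the
  squared norm at \<open>y\<close>, so it cannot exceed the maximum.\<close>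

lemma Q_index_maximizer:
  assumes "pverts G \<noteq> {}"
  obtains x where "\<And>v. 0 \<le> x v" and "(\<Sum>v\<in>pverts G. (x v)\<^sup>2) = 1"
    and "signless_form G x = Q_index G"
    and "\<And>y. signless_form G y \<le> Q_index G * (\<Sum>v\<in>pverts G. (y v)\<^sup>2)"
proof -
  obtain x where x: "\<And>v. 0 \<le> x v" "(\<Sum>v\<in>pverts G. (x v)\<^sup>2) = 1"
    and max: "\<And>y. signless_form G y \<le> signless_form G x * (\<Sum>v\<in>pverts G. (y v)\<^sup>2)"
    using signless_form_attains_max[OF assms] by metis
  have eig: "\<forall>u\<in>pverts G. signless_op G x u = signless_form G x * x u"
    using signless_op_maximizer[of "signless_form G x" x] max x(2) by simp
  have nz: "\<exists>v\<in>pverts G. x v \<noteq> 0"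
  proof (rule ccontr)
    assume "\<not> (\<exists>v\<in>pverts G. x v \<noteq> 0)"
    then have "(\<Sum>v\<in>pverts G. (x v)\<^sup>2) = 0" by simp
    with x(2) show False by simp
  qed
  have upper: "r \<le> signless_form G x"
    if nz: "\<exists>v\<in>pverts G. y v \<noteq> 0" and y: "\<forall>u\<in>pverts G. signless_op G y u = r * y u" for r y
  proof -
    have "signless_form G y = r * (\<Sum>v\<in>pverts G. (y v)\<^sup>2)"
      using y by (simp add: signless_form_eq_op sum_distrib_left power2_eq_square algebra_simps)
    moreover have "(\<Sum>v\<in>pverts G. (y v)\<^sup>2) > 0"
      using nz pair_finite_verts by (auto intro: sum_pos2)
    ultimately show ?thesis
      using max[of y] by simp
  qed
  have "Q_index G = signless_form G x"
    unfolding Q_index_eq_Max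
  proof (rule Max_eqI[OF finite_signless_eigenvalues])
    show "signless_form G x
        \<in> {r. \<exists>x. (\<exists>v\<in>pverts G. x v \<noteq> 0) \<and> (\<forall>u\<in>pverts G. signless_op G x u = r * x u)}"
      using eig nz by blast
  qed (use upper in blast)
  then show thesis
    using that[OF x] max by simp
qed

lemma signless_form_le_Q_index: "signless_form G y \<le> Q_index G * (\<Sum>v\<in>pverts G. (y v)\<^sup>2)"
proof (cases "pverts G = {}")
  \<comment> \<open>Without vertices \<open>Q_index G\<close> is the \<open>Max\<close> of an empty
    set, but it is multiplied by an empty sum.\<close>
  case True
  then have "parcs G = {}" by (auto dest: in_arcsD1)
  then show ?thesis using True by (simp add: signless_form_def)
next
  case False
  then show ?thesis using Q_index_maximizer by metis
qed

text \<open>A nonnegative maximiser is an eigenfunction, hence positive on a connected graph.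
  Positivity makes the later comparisons strict.\<close>

lemma Perron_function:
  assumes "Digraph_Component.connected (with_proj G)"
  obtains x where "\<And>v. v \<in> pverts G \<Longrightarrow> 0 < x v" and "(\<Sum>v\<in>pverts G. (x v)\<^sup>2) = 1"
    and "signless_form G x = Q_index G"
proof -
  have "pverts G \<noteq> {}"
    using assms by (auto simp: connected_def strongly_connected_def mk_symmetric_def)
  then obtain x where x: "\<And>v. 0 \<le> x v" "(\<Sum>v\<in>pverts G. (x v)\<^sup>2) = 1"
    and form: "signless_form G x = Q_index G"
    and max: "\<And>y. signless_form G y \<le> Q_index G * (\<Sum>v\<in>pverts G. (y v)\<^sup>2)"
    using Q_index_maximizer by metis
  have "signless_op G x u = Q_index G * x u" if "u \<in> pverts G" for u
    by (rule signless_op_maximizer[OF max _ that]) (simp add: form x)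
  then have "0 < x v" if "v \<in> pverts G" for v
    using that by (intro pos_if_eigenfunction[OF assms, of x "Q_index G"]) (auto simp: x)
  then show thesis using that x form by blast
qed

end

section \<open>Isomorphism invariance of the \<open>Q\<close>-index\<close>

text \<open>A graph isomorphism is determined by its action on the vertices, as arcs are pairs.\<close>

lemma digraph_iso_with_proj_iff:
  assumes "pair_wf_digraph G"
  shows "digraph_iso (with_proj G) (with_proj H) \<longleftrightarrow>
    (\<exists>f. inj_on f (pverts G) \<and> pverts H = f ` pverts G \<and> parcs H = map_prod f f ` parcs G)"
proof
  assume "digraph_iso (with_proj G) (with_proj H)"
  then obtain h where h: "pre_digraph.digraph_isomorphism (with_proj G) h"
    and H: "with_proj H = app_iso h (with_proj G)"
    by (auto simp: digraph_iso_def)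
  have tail: "iso_tail h = fst" and head: "iso_head h = snd"
    and verts: "pverts H = iso_verts h ` pverts G" and arcs: "parcs H = iso_arcs h ` parcs G"
    using H by (simp_all add: with_proj_def app_iso_def)
  have "iso_arcs h e = map_prod (iso_verts h) (iso_verts h) e" if "e \<in> parcs G" for e
    using h that unfolding pre_digraph.digraph_isomorphism_def
    by (auto simp: tail head prod_eq_iff map_prod_def case_prod_unfold)
  then have "parcs H = map_prod (iso_verts h) (iso_verts h) ` parcs G"
    unfolding arcs by (intro image_cong) auto
  then show "\<exists>f. inj_on f (pverts G) \<and> pverts H = f ` pverts G \<and> parcs H = map_prod f f ` parcs G"
    using h verts by (auto simp: pre_digraph.digraph_isomorphism_def)
next
  assume "\<exists>f. inj_on f (pverts G) \<and> pverts H = f ` pverts G \<and> parcs H = map_prod f f ` parcs G"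
  then obtain f where f: "inj_on f (pverts G)" "pverts H = f ` pverts G"
    "parcs H = map_prod f f ` parcs G" by blast
  interpret pair_wf_digraph G by fact
  let ?h = "\<lparr>iso_verts = f, iso_arcs = map_prod f f, iso_head = snd, iso_tail = fst\<rparr>"
  have "parcs G \<subseteq> pverts G \<times> pverts G"
    by (auto dest: in_arcsD1 in_arcsD2)
  then have "inj_on (map_prod f f) (parcs G)"
    using map_prod_inj_on[OF f(1) f(1)] inj_on_subset by blast
  then have "digraph_isomorphism ?h"
    using f(1) by (auto simp: digraph_isomorphism_def wf_digraph_axioms)
  moreover have "with_proj H = app_iso ?h (with_proj G)"
    using f by (simp add: with_proj_def app_iso_def)
  ultimately show "digraph_iso (with_proj G) (with_proj H)"
    unfolding digraph_iso_def by blast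
qed

text \<open>Composition with the vertex bijection or its inverse turns eigenfunctions of one graph
  into eigenfunctions of the other, so the two sets of eigenvalues coincide.\<close>

lemma Q_index_iso:
  assumes "pair_graph G" "pair_graph H" "digraph_iso (with_proj G) (with_proj H)"
  shows "Q_index G = Q_index H"
proof -
  interpret G: pair_graph G by fact
  interpret H: pair_graph H by fact
  obtain f where inj: "inj_on f (pverts G)" and verts: "pverts H = f ` pverts G"
    and arcs: "parcs H = map_prod f f ` parcs G"
    using assms(3) by (auto simp: digraph_iso_with_proj_iff[OF G.pair_wf_digraph])
  have nbrs: "{v. (f u, v) \<in> parcs H} = f ` {v. (u, v) \<in> parcs G}" if "u \<in> pverts G" for u
  proof (intro equalityI subsetI)
    fix w assume "w \<in> {v. (f u, v) \<in> parcs H}"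
    then obtain a b where ab: "(a, b) \<in> parcs G" "f a = f u" "w = f b"
      by (auto simp: arcs)
    then have "a = u"
      using inj that G.in_arcsD1 by (auto dest: inj_onD)
    then show "w \<in> f ` {v. (u, v) \<in> parcs G}"
      using ab by auto
  next
    fix w assume "w \<in> f ` {v. (u, v) \<in> parcs G}"
    then obtain b where "(u, b) \<in> parcs G" "w = f b" by blast
    then show "w \<in> {v. (f u, v) \<in> parcs H}"
      using map_prod_imageI[of u b "parcs G" f f] by (simp add: arcs)
  qed
  have op: "signless_op H y (f u) = signless_op G (y \<circ> f) u" if "u \<in> pverts G" for y u
  proof -
    have "inj_on f {v. (u, v) \<in> parcs G}"
      by (rule inj_on_subset[OF inj]) (auto dest: G.in_arcsD2)
    then show ?thesis
      by (simp add: signless_op_def nbrs[OF that] sum.reindex card_image)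
  qed
  define g where "g = the_inv_into (pverts G) f"
  have g: "g (f u) = u" if "u \<in> pverts G" for u
    using the_inv_into_f_f[OF inj that] by (simp add: g_def)
  \<comment> \<open>\<open>x \<circ> g \<circ> f\<close> is known to agree with \<open>x\<close> on
    the vertices only, and \<open>signless_op\<close> at a vertex reads nothing else.\<close>
  have opg: "signless_op G (x \<circ> g \<circ> f) u = signless_op G x u" if "u \<in> pverts G" for x u
    unfolding signless_op_def using that
    by (intro sum.cong) (auto simp: g dest: G.in_arcsD2)
  have "(\<exists>x. (\<exists>v\<in>pverts G. x v \<noteq> 0) \<and> (\<forall>u\<in>pverts G. signless_op G x u = r * x u)) \<longleftrightarrow>
        (\<exists>y. (\<exists>v\<in>pverts H. y v \<noteq> 0) \<and> (\<forall>u\<in>pverts H. signless_op H y u = r * y u))"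
    (is "?L \<longleftrightarrow> ?R") for r
  proof
    assume ?L
    then obtain x where "\<exists>v\<in>pverts G. x v \<noteq> 0" "\<forall>u\<in>pverts G. signless_op G x u = r * x u"
      by blast
    then show ?R
      by (intro exI[of _ "x \<circ> g"]) (simp add: verts op g opg)
  next
    assume ?R
    then obtain y where "\<exists>v\<in>pverts H. y v \<noteq> 0" "\<forall>u\<in>pverts H. signless_op H y u = r * y u"
      by blast
    then show ?L
      by (intro exI[of _ "y \<circ> f"]) (simp add: verts op)
  qed
  then show ?thesis
    by (simp add: G.Q_index_eq_Max H.Q_index_eq_Max)
qed

subsection \<open>Two cliques joined to a third one\<close>

lemma obtain_smallest_subset:
  fixes f :: "'a \<Rightarrow> 'b :: linorder"
  assumes "finite W" "m \<le> card W"
  obtains S where "S \<subseteq> W" "card S = m" "\<And>u v. u \<in> S \<Longrightarrow> v \<in> W - S \<Longrightarrow> f u \<le> f v"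
proof -
  have "\<exists>S\<subseteq>W. card S = m \<and> (\<forall>u\<in>S. \<forall>v\<in>W - S. f u \<le> f v)"
    using assms(2)
  proof (induction m)
    case 0
    then show ?case by (intro exI[of _ "{}"]) auto
  next
    case (Suc m)
    then obtain S where S: "S \<subseteq> W" "card S = m" "\<forall>u\<in>S. \<forall>v\<in>W - S. f u \<le> f v"
      by auto
    have fin: "finite (W - S)" "finite S"
      using assms(1) S(1) finite_subset by auto
    have "S \<noteq> W" using S(2) Suc.prems by auto
    then have "W - S \<noteq> {}" using S(1) by auto
    \<comment> \<open>Greedy step: add a minimiser of \<open>f\<close> among the elements not yet
      chosen.\<close>
    from obtains_MIN[OF fin(1) this, of f] obtain w
      where w: "w \<in> W - S" "f w = Min (f ` (W - S))" by metis
    then have "f w \<le> f v" if "v \<in> W - S" for v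
      using fin that by simp
    then show ?case
      using S w(1) fin by (intro exI[of _ "insert w S"]) auto
  qed
  then show thesis using that by blast
qed

text \<open>Let \<open>t\<close> be the largest value on \<open>S - T\<close>. Values on
  \<open>T - S\<close> are at least \<open>t\<close>, and \<open>T - S\<close> has at least as many
  elements; as \<open>t\<close> is nonnegative, surplus elements only help. If \<open>S - T\<close>
  is empty there is no such \<open>t\<close>, and monotonicity suffices.\<close>

lemma sum_smallest_le:
  fixes f :: "'a \<Rightarrow> 'b :: linordered_idom"
  assumes fin: "finite W" and sub: "S \<subseteq> W" "T \<subseteq> W" and card: "card S \<le> card T"
    and small: "\<And>u v. u \<in> S \<Longrightarrow> v \<in> W - S \<Longrightarrow> f u \<le> f v"
    and nonneg: "\<And>v. v \<in> W \<Longrightarrow> 0 \<le> f v"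
  shows "sum f S \<le> sum f T"
proof (cases "S \<subseteq> T")
  case True
  then show ?thesis
    using fin sub nonneg by (intro sum_mono2) (auto intro: finite_subset)
next
  case False
  have finS: "finite S" and finT: "finite T"
    using fin sub finite_subset by auto
  define t where "t = Max (f ` (S - T))"
  have t: "t \<in> f ` (S - T)"
    unfolding t_def using finS False by (intro Max_in) auto
  have card': "card (S - T) \<le> card (T - S)"
    using card card_Diff_subset_Int[of S T] card_Diff_subset_Int[of T S] finS finT
    by (simp add: Int_commute)
  have "sum f (S - T) \<le> of_nat (card (S - T)) * t"
    using finS by (intro sum_bounded_above) (auto simp: t_def)
  also have "\<dots> \<le> of_nat (card (T - S)) * t"
    using card' t nonneg sub by (intro mult_right_mono) auto
  also have "\<dots> \<le> sum f (T - S)"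
    using t small sub by (intro sum_bounded_below) auto
  finally have "sum f (S - T) + sum f (S \<inter> T) \<le> sum f (T - S) + sum f (S \<inter> T)"
    by simp
  moreover have "sum f S = sum f (S - T) + sum f (S \<inter> T)"
    using finS by (subst sum.union_disjoint[symmetric]) (auto intro!: sum.cong)
  moreover have "sum f T = sum f (T - S) + sum f (S \<inter> T)"
    using finT by (subst sum.union_disjoint[symmetric]) (auto intro!: sum.cong)
  ultimately show ?thesis by simp
qed

text \<open>\<open>T\<close> can spare one element and still be large enough for the weak
  inequality; the positive value of that element gives strictness.\<close>

lemma sum_smallest_less:
  fixes f :: "'a \<Rightarrow> 'b :: linordered_idom"
  assumes fin: "finite W" and sub: "S \<subseteq> W" "T \<subseteq> W" and card: "card S < card T"
    and small: "\<And>u v. u \<in> S \<Longrightarrow> v \<in> W - S \<Longrightarrow> f u \<le> f v"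
    and pos: "\<And>v. v \<in> W \<Longrightarrow> 0 < f v"
  shows "sum f S < sum f T"
proof -
  have finT: "finite T" using fin sub finite_subset by auto
  obtain t where t: "t \<in> T"
    using card by fastforce
  have "sum f S \<le> sum f (T - {t})"
    using fin sub card small pos t finT
    by (intro sum_smallest_le[of W]) (auto simp: less_imp_le)
  also have "\<dots> < sum f T"
    using t finT sub pos by (simp add: sum.remove[of T t] subset_iff)
  finally show ?thesis .
qed

text \<open>The extremal graph on prescribed vertex sets instead of a sum type, so that it can share
  the vertices of \<open>G\<close> and be compared with it arc by arc.\<close>

definition clique_pair :: "'a set \<Rightarrow> 'a set \<Rightarrow> 'a set \<Rightarrow> 'a pair_pre_digraph" where
  "clique_pair C A B = \<lparr>pverts = C \<union> A \<union> B,
    parcs = {(u, v). u \<in> C \<union> A \<union> B \<and> v \<in> C \<union> A \<union> B \<and> u \<noteq> v} - A \<times> B - B \<times> A\<rparr>"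

lemma pair_graph_clique_pair:
  assumes "finite C" "finite A" "finite B"
  shows "pair_graph (clique_pair C A B)"
proof
  show "finite (parcs (clique_pair C A B))"
    by (rule finite_subset[of _ "(C \<union> A \<union> B) \<times> (C \<union> A \<union> B)"])
      (use assms in \<open>auto simp: clique_pair_def\<close>)
qed (use assms in \<open>auto simp: clique_pair_def symmetric_def intro!: symI\<close>)

lemma map_prod_parcs_clique_pair:
  assumes inj: "inj_on f (C \<union> A \<union> B)"
  shows "map_prod f f ` parcs (clique_pair C A B) = parcs (clique_pair (f ` C) (f ` A) (f ` B))"
proof -
  have mem: "f v \<in> f ` S \<longleftrightarrow> v \<in> S" if "v \<in> C \<union> A \<union> B" "S \<subseteq> C \<union> A \<union> B" for v S
    using inj_on_image_mem_iff[OF inj that] .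
  have arc: "(f u, f v) \<in> parcs (clique_pair (f ` C) (f ` A) (f ` B)) \<longleftrightarrow> (u, v) \<in> parcs (clique_pair C A B)"
    if "u \<in> C \<union> A \<union> B" "v \<in> C \<union> A \<union> B" for u v
    using that mem[of u A] mem[of v A] mem[of u B] mem[of v B] inj_on_eq_iff[OF inj that]
    unfolding clique_pair_def by auto
  have sub: "parcs (clique_pair C A B) \<subseteq> (C \<union> A \<union> B) \<times> (C \<union> A \<union> B)" for C A B :: "'c set"
    by (auto simp: clique_pair_def)
  show ?thesis
  proof (intro equalityI subsetI)
    fix e assume "e \<in> map_prod f f ` parcs (clique_pair C A B)"
    then obtain u v where uv: "(u, v) \<in> parcs (clique_pair C A B)" "e = (f u, f v)"
      by auto
    then show "e \<in> parcs (clique_pair (f ` C) (f ` A) (f ` B))"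
      using arc[of u v] sub[of C A B] by blast
  next
    fix e assume e: "e \<in> parcs (clique_pair (f ` C) (f ` A) (f ` B))"
    then have "e \<in> f ` (C \<union> A \<union> B) \<times> f ` (C \<union> A \<union> B)"
      using sub[of "f ` C" "f ` A" "f ` B"] unfolding image_Un by blast
    then obtain u v where uv: "u \<in> C \<union> A \<union> B" "v \<in> C \<union> A \<union> B" "e = (f u, f v)"
      by blast
    then have "(u, v) \<in> parcs (clique_pair C A B)"
      using arc e by blast
    then show "e \<in> map_prod f f ` parcs (clique_pair C A B)"
      unfolding uv(3) by (rule map_prod_imageI)
  qed
qed

text \<open>The summands sit in the sum type as three disjoint images, so the graph of the theorem
  is literally a \<open>clique_pair\<close>, not just isomorphic to one.\<close>

lemma graph_join_complete_eq_clique_pair: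
  "graph_join (complete_graph c) (graph_union (complete_graph a) (complete_graph b))
    = clique_pair (Inl ` {0..<c}) (Inr ` Inl ` {0..<a}) (Inr ` Inr ` {0..<b})" (is "?J = ?K")
proof -
  have cases: thesis if "\<And>x. p = Inl x \<Longrightarrow> thesis" "\<And>x. p = Inr (Inl x) \<Longrightarrow> thesis"
    "\<And>x. p = Inr (Inr x) \<Longrightarrow> thesis" for p :: "nat + nat + nat" and thesis
    using that by (metis sum.exhaust)
  have mem: "(Inl u, Inl v) \<in> map_prod Inl Inl ` S \<longleftrightarrow> (u, v) \<in> S"
    "(Inr u, Inr v) \<in> map_prod Inr Inr ` S \<longleftrightarrow> (u, v) \<in> S"
    for S :: "'c rel" and u v
    by auto
  have "(p, q) \<in> parcs ?J \<longleftrightarrow> (p, q) \<in> parcs ?K" for p q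
    by (cases p rule: cases; cases q rule: cases)
      (auto simp: graph_join_def graph_union_def complete_graph_def clique_pair_def mem)
  then have "parcs ?J = parcs ?K"
    by auto
  moreover have "pverts ?J = pverts ?K"
    by (auto simp: graph_join_def graph_union_def complete_graph_def clique_pair_def)
  ultimately show ?thesis
    by simp
qed

text \<open>Numberings of the three disjoint sets are glued to one injection \<open>k\<close>, which
  maps the sets onto the three summands.\<close>

lemma digraph_iso_clique_pair:
  assumes fin: "finite C" "finite A" "finite B"
    and disj: "C \<inter> A = {}" "C \<inter> B = {}" "A \<inter> B = {}"
  shows "digraph_iso (with_proj (clique_pair C A B)) (with_proj (graph_join (complete_graph (card C))
           (graph_union (complete_graph (card A)) (complete_graph (card B)))))"
proof -
  obtain f g h where f: "bij_betw f C {0..<card C}" and g: "bij_betw g A {0..<card A}"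
    and h: "bij_betw h B {0..<card B}"
    using fin ex_bij_betw_finite_nat by metis
  define k where "k v = (if v \<in> C then Inl (f v) else if v \<in> A then Inr (Inl (g v)) else Inr (Inr (h v)))"
    for v
  have kC: "k v = Inl (f v)" if "v \<in> C" for v
    using that by (simp add: k_def)
  have kA: "k v = Inr (Inl (g v))" if "v \<in> A" for v
    using that disj(1) by (auto simp: k_def)
  have kB: "k v = Inr (Inr (h v))" if "v \<in> B" for v
    using that disj(2,3) by (auto simp: k_def)
  have "k ` C = Inl ` f ` C" "k ` A = Inr ` Inl ` g ` A" "k ` B = Inr ` Inr ` h ` B"
    unfolding image_image by (auto intro!: image_cong simp: kA kB kC)
  then have img: "k ` C = Inl ` {0..<card C}" "k ` A = Inr ` Inl ` {0..<card A}"
    "k ` B = Inr ` Inr ` {0..<card B}"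
    using f g h by (simp_all add: bij_betw_def)
  have "inj_on k C" "inj_on k A" "inj_on k B"
    using f g h by (simp_all add: kA kB kC bij_betw_def inj_on_def)
  then have inj: "inj_on k (C \<union> A \<union> B)"
    using disj by (auto simp: inj_on_Un kA kB kC)
  interpret K: pair_graph "clique_pair C A B"
    using fin by (rule pair_graph_clique_pair)
  let ?J = "graph_join (complete_graph (card C))
    (graph_union (complete_graph (card A)) (complete_graph (card B)))"
  have J: "?J = clique_pair (k ` C) (k ` A) (k ` B)"
    unfolding img by (rule graph_join_complete_eq_clique_pair)
  have "pverts ?J = k ` pverts (clique_pair C A B)"
    unfolding J by (simp add: clique_pair_def image_Un)
  moreover have "parcs ?J = map_prod k k ` parcs (clique_pair C A B)"
    unfolding J by (rule map_prod_parcs_clique_pair[OF inj, symmetric])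
  moreover have "inj_on k (pverts (clique_pair C A B))"
    using inj by (simp add: clique_pair_def)
  ultimately show ?thesis
    unfolding digraph_iso_with_proj_iff[OF K.pair_wf_digraph] by blast
qed

section \<open>Weight of the missing edges\<close>

lemma sum_square_product:
  fixes x :: "'a \<Rightarrow> real"
  shows "(\<Sum>(u, v)\<in>A \<times> B. (x u + x v)\<^sup>2)
    = card B * (\<Sum>u\<in>A. (x u)\<^sup>2) + card A * (\<Sum>v\<in>B. (x v)\<^sup>2) + 2 * sum x A * sum x B"
proof -
  have "(\<Sum>(u, v)\<in>A \<times> B. (x u + x v)\<^sup>2) = (\<Sum>u\<in>A. \<Sum>v\<in>B. (x u)\<^sup>2 + (x v)\<^sup>2 + 2 * (x u * x v))"
    unfolding sum.cartesian_product by (simp add: power2_sum mult.assoc)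
  also have "\<dots> = (\<Sum>u\<in>A. \<Sum>v\<in>B. (x u)\<^sup>2) + (\<Sum>u\<in>A. \<Sum>v\<in>B. (x v)\<^sup>2)
      + (\<Sum>u\<in>A. \<Sum>v\<in>B. 2 * (x u * x v))"
    unfolding sum.distrib ..
  also have "(\<Sum>u\<in>A. \<Sum>v\<in>B. 2 * (x u * x v)) = 2 * (\<Sum>u\<in>A. \<Sum>v\<in>B. x u * x v)"
    unfolding sum_distrib_left ..
  also have "(\<Sum>u\<in>A. \<Sum>v\<in>B. x u * x v) = sum x A * sum x B"
    by (simp add: sum_product)
  finally show ?thesis
    by (simp flip: sum_distrib_left)
qed

text \<open>The first sum belongs to the complete graph and depends on \<open>A\<close> and
  \<open>B\<close> only through their union, so redistributing vertices between them changes just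
  the subtracted weight. The bracketing \<open>C \<union> (A \<union> B)\<close> lets an equation
  between unions rewrite it.\<close>

lemma signless_form_clique_pair:
  fixes x :: "'a \<Rightarrow> real"
  assumes fin: "finite C" "finite A" "finite B" and disj: "A \<inter> B = {}"
  shows "signless_form (clique_pair C A B) x
    = (\<Sum>(u, v) | u \<in> C \<union> (A \<union> B) \<and> v \<in> C \<union> (A \<union> B) \<and> u \<noteq> v. (x u + x v)\<^sup>2) / 2
      - (card B * (\<Sum>u\<in>A. (x u)\<^sup>2) + card A * (\<Sum>v\<in>B. (x v)\<^sup>2) + 2 * sum x A * sum x B)"
proof -
  let ?g = "\<lambda>(u, v). (x u + x v)\<^sup>2"
  let ?F = "{(u, v). u \<in> C \<union> (A \<union> B) \<and> v \<in> C \<union> (A \<union> B) \<and> u \<noteq> v}"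
  have finF: "finite ?F"
    by (rule finite_subset[of _ "(C \<union> A \<union> B) \<times> (C \<union> A \<union> B)"]) (use fin in auto)
  have "sum ?g (parcs (clique_pair C A B)) = sum ?g (?F - (A \<times> B \<union> B \<times> A))"
    by (intro sum.cong) (auto simp: clique_pair_def)
  also have "\<dots> = sum ?g ?F - sum ?g (A \<times> B \<union> B \<times> A)"
    using disj finF by (subst sum.subset_diff[of "A \<times> B \<union> B \<times> A" ?F]) auto
  also have "sum ?g (A \<times> B \<union> B \<times> A) = sum ?g (A \<times> B) + sum ?g (B \<times> A)"
    using disj fin by (intro sum.union_disjoint) auto
  finally show ?thesis
    unfolding signless_form_def sum_square_product by (simp add: field_simps)
qed

text \<open>Here \<open>a, b, m\<close> are the sizes of two cliques and of the new smaller one, \<open>p, q, p', q'\<close> and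
  \<open>s, t, s', t'\<close> the sums of the squares and of the values of a function on the old and new cliques.\<close>

lemma missing_edges_decrease:
  fixes a b m :: real
  assumes "m \<le> a" "a \<le> b" and p: "p' + q' = p + q" "p' \<le> p" "p' \<le> q"
    and s: "s' + t' = s + t" "s' < s" "s' < t"
  shows "(a + b - m) * p' + m * q' + 2 * s' * t' < b * p + a * q + 2 * s * t"
proof -
  \<comment> \<open>This product is exactly \<open>s * t - s' * t'\<close>.\<close>
  have "(s - s') * (t - s') > 0"
    using s by simp
  moreover have t': "t' = s + t - s'" using s by simp
  ultimately have "s' * t' < s * t"
    unfolding t' by (simp add: algebra_simps)
  moreover have "(a + b - m) * p' + m * q' \<le> b * p + a * q"
  proof -
    have q': "q' = p + q - p'" using p by simp
    \<comment> \<open>This is the right-hand side minus the left-hand side after eliminating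
      \<open>q'\<close>.\<close>
    have "0 \<le> (b - m) * (p - p') + (a - m) * (q - p')"
      using assms by simp
    then show ?thesis
      unfolding q' by (simp add: algebra_simps)
  qed
  ultimately show ?thesis by simp
qed

text \<open>Both old sides have more than \<open>m\<close> vertices, so the \<open>m\<close>
  smallest values have a smaller sum than either side, and \<open>missing_edges_decrease\<close>
  applies.\<close>

lemma signless_form_shrink_clique:
  fixes x :: "'a \<Rightarrow> real"
  assumes fin: "finite C" "finite A" "finite B" and disj: "A \<inter> B = {}"
    and card: "m < card A" "card A \<le> card B"
    and pos: "\<And>v. v \<in> A \<union> B \<Longrightarrow> 0 < x v"
  obtains A' B' where "A' \<union> B' = A \<union> B" "A' \<inter> B' = {}" "card A' = m"
    "signless_form (clique_pair C A B) x < signless_form (clique_pair C A' B') x"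
proof -
  define W where "W = A \<union> B"
  have finW: "finite W" and posW: "\<And>v. v \<in> W \<Longrightarrow> 0 < x v"
    using fin pos by (auto simp: W_def)
  have cardW: "card W = card A + card B"
    unfolding W_def using fin disj by (intro card_Un_disjoint)
  then obtain A' where A': "A' \<subseteq> W" "card A' = m"
    and small: "\<And>u v. u \<in> A' \<Longrightarrow> v \<in> W - A' \<Longrightarrow> x u \<le> x v"
    using obtain_smallest_subset[OF finW, of m x] card by auto
  \<comment> \<open>\<open>x\<close> is positive, so squaring keeps the order and the same
    \<open>A'\<close> is smallest for the squares.\<close>
  have small2: "(x u)\<^sup>2 \<le> (x v)\<^sup>2" if "u \<in> A'" "v \<in> W - A'" for u v
    using small[OF that] posW[of u] that A'(1) by (intro power_mono) auto
  define B' where "B' = W - A'"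
  have finA': "finite A'" using A'(1) finW finite_subset by blast
  have finB': "finite B'"
    using finW by (simp add: B'_def)
  have part: "A' \<union> B' = A \<union> B" "A' \<inter> B' = {}"
    using A'(1) by (auto simp: B'_def W_def)
  have sums: "sum g A' + sum g B' = sum g A + sum g B" for g :: "'a \<Rightarrow> real"
    using fin finA' finW disj part
    by (simp add: B'_def W_def flip: sum.union_disjoint)
  have cardB': "real (card B') = real (card A) + real (card B) - real m"
    using A' finA' finW cardW card unfolding B'_def by (simp add: card_Diff_subset)
  have "(real (card A) + real (card B) - real m) * (\<Sum>u\<in>A'. (x u)\<^sup>2) + real m * (\<Sum>v\<in>B'. (x v)\<^sup>2)
        + 2 * sum x A' * sum x B'
      < card B * (\<Sum>u\<in>A. (x u)\<^sup>2) + card A * (\<Sum>v\<in>B. (x v)\<^sup>2) + 2 * sum x A * sum x B"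
  proof (rule missing_edges_decrease)
    show "(\<Sum>u\<in>A'. (x u)\<^sup>2) \<le> (\<Sum>u\<in>A. (x u)\<^sup>2)" "(\<Sum>u\<in>A'. (x u)\<^sup>2) \<le> (\<Sum>u\<in>B. (x u)\<^sup>2)"
      using A' card small2 finW by (auto intro!: sum_smallest_le[of W] simp: W_def)
    show "sum x A' < sum x A" "sum x A' < sum x B"
      using A' card small finW posW by (auto intro!: sum_smallest_less[of W] simp: W_def)
  qed (use card sums in auto)
  then have "signless_form (clique_pair C A B) x < signless_form (clique_pair C A' B') x"
    unfolding signless_form_clique_pair[OF fin disj]
      signless_form_clique_pair[OF fin(1) finA' finB' part(2)] part(1) cardB' A'(2)
    by simp
  then show thesis
    using that part A'(2) by blast
qed

subsection \<open>Vertex-cuts\<close>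

context pair_graph
begin

text \<open>Connectedness is defined through the symmetric closure, which adds no arcs here because
  those of \<open>G\<close> come in opposite pairs.\<close>

lemma mk_symmetric_induce:
  "mk_symmetric (with_proj G \<restriction> S) = \<lparr>pverts = S, parcs = {(u, v) \<in> parcs G. u \<in> S \<and> v \<in> S}\<rparr>"
proof -
  have "(\<Union>e\<in>{e \<in> parcs G. fst e \<in> S \<and> snd e \<in> S}. {(fst e, snd e), (snd e, fst e)})
      = {(u, v) \<in> parcs G. u \<in> S \<and> v \<in> S}" (is "?L = ?R")
  proof (intro equalityI subsetI)
    fix e assume "e \<in> ?L"
    then show "e \<in> ?R"
      using arcs_symmetric by auto
  next
    fix e assume "e \<in> ?R"
    then have "e \<in> {e \<in> parcs G. fst e \<in> S \<and> snd e \<in> S}" "e = (fst e, snd e)"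
      by auto
    then show "e \<in> ?L" by blast
  qed
  then show ?thesis
    by (simp add: mk_symmetric_def induce_subgraph_def with_proj_def)
qed

text \<open>If \<open>v\<close> is not reachable from \<open>u\<close>, the set reachable from
  \<open>u\<close> is one side, as no arc leaves it. Conversely, reachability never crosses a
  separation.\<close>

lemma not_connected_induce_iff:
  assumes "S \<noteq> {}"
  shows "\<not> Digraph_Component.connected (with_proj G \<restriction> S) \<longleftrightarrow>
    (\<exists>A B. A \<noteq> {} \<and> B \<noteq> {} \<and> A \<union> B = S \<and> A \<inter> B = {} \<and> parcs G \<inter> A \<times> B = {})"
proof -
  define H where "H = \<lparr>pverts = S, parcs = {(u, v) \<in> parcs G. u \<in> S \<and> v \<in> S}\<rparr>"
  have H: "pverts H = S" "parcs H = {(u, v) \<in> parcs G. u \<in> S \<and> v \<in> S}"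
    by (simp_all add: H_def)
  interpret H: pair_wf_digraph H
    by unfold_locales (auto simp: H)
  have conn: "Digraph_Component.connected (with_proj G \<restriction> S)
      \<longleftrightarrow> (\<forall>u\<in>S. \<forall>v\<in>S. u \<rightarrow>\<^sup>*\<^bsub>with_proj H\<^esub> v)"
    unfolding connected_def mk_symmetric_induce H_def[symmetric] strongly_connected_def
    using assms by (simp add: H)
  show ?thesis
  proof
    assume "\<not> Digraph_Component.connected (with_proj G \<restriction> S)"
    then obtain u v where uv: "u \<in> S" "v \<in> S" "\<not> u \<rightarrow>\<^sup>*\<^bsub>with_proj H\<^esub> v"
      unfolding conn by blast
    define A where "A = {w. u \<rightarrow>\<^sup>*\<^bsub>with_proj H\<^esub> w}"
    have "A \<subseteq> S"
      using H.reachable_in_verts(2)[of u] unfolding A_def H by blast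
    have "u \<in> A"
      using uv(1) H.reachable_refl[of u] by (simp add: A_def H)
    have "b \<in> A" if "(a, b) \<in> parcs G" "a \<in> A" "b \<in> S" for a b
    proof -
      have "a \<in> S"
        using that(2) \<open>A \<subseteq> S\<close> by blast
      then have "(a, b) \<in> parcs H"
        using that by (simp add: H)
      then show ?thesis
        using H.reachable_adj_trans[of u a b] that(2) by (simp add: A_def)
    qed
    then have "parcs G \<inter> A \<times> (S - A) = {}"
      by blast
    moreover have "S - A \<noteq> {}"
      using uv(2,3) by (auto simp: A_def)
    ultimately show "\<exists>A B. A \<noteq> {} \<and> B \<noteq> {} \<and> A \<union> B = S \<and> A \<inter> B = {} \<and> parcs G \<inter> A \<times> B = {}"
      using \<open>u \<in> A\<close> \<open>A \<subseteq> S\<close> by (intro exI[of _ A] exI[of _ "S - A"] conjI) auto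
  next
    assume "\<exists>A B. A \<noteq> {} \<and> B \<noteq> {} \<and> A \<union> B = S \<and> A \<inter> B = {} \<and> parcs G \<inter> A \<times> B = {}"
    then obtain A B u v where AB: "u \<in> A" "v \<in> B" "A \<union> B = S" "A \<inter> B = {}"
      and sep: "parcs G \<inter> A \<times> B = {}" by blast
    have "w \<in> A" if "u \<rightarrow>\<^sup>*\<^bsub>with_proj H\<^esub> w" for w
      using that
    proof (induction rule: H.reachable_induct)
      case base
      show ?case by fact
    next
      case (step a b)
      then have "(a, b) \<in> parcs G" "b \<in> S" by (auto simp: H)
      then show ?case using step.IH sep AB(3) by blast
    qed
    then have "\<not> u \<rightarrow>\<^sup>*\<^bsub>with_proj H\<^esub> v"
      using AB by blast
    then show "\<not> Digraph_Component.connected (with_proj G \<restriction> S)"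
      unfolding conn using AB by blast
  qed
qed

text \<open>As \<open>G\<close> has no loops, a single remaining vertex always forms
  \<open>K_1\<close>, so that alternative becomes a cardinality.\<close>

lemma vertex_cut_iff:
  "vertex_cut G C \<longleftrightarrow> C \<subset> pverts G \<and>
    (card (pverts G - C) = 1 \<or>
     (\<exists>A B. A \<noteq> {} \<and> B \<noteq> {} \<and> A \<union> B = pverts G - C \<and> A \<inter> B = {} \<and> parcs G \<inter> A \<times> B = {}))"
proof (cases "C \<subset> pverts G")
  case True
  define H where "H = \<lparr>pverts = pverts G - C,
    parcs = {(u, v) \<in> parcs G. u \<in> pverts G - C \<and> v \<in> pverts G - C}\<rparr>"
  have induce: "with_proj G \<restriction> (pverts G - C) = with_proj H"
    by (auto simp: H_def with_proj_def induce_subgraph_def)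
  have complete: "complete_digraph 1 (with_proj H) \<longleftrightarrow> card (pverts G - C) = 1"
  proof
    assume "card (pverts G - C) = 1"
    then obtain w where "pverts G - C = {w}"
      by (auto simp: card_1_singleton_iff)
    then have "pverts H = {w}" "parcs H = {}"
      using no_loops' by (auto simp: H_def)
    then show "complete_digraph 1 (with_proj H)"
      unfolding complete_digraph_pair_def by auto
  qed (simp add: complete_digraph_pair_def H_def)
  have "pverts G - C \<noteq> {}"
    using True by blast
  from not_connected_induce_iff[OF this] show ?thesis
    unfolding vertex_cut_def Let_def induce complete by (simp add: True disj_commute)
qed (simp add: vertex_cut_def)

text \<open>Deleting all vertices but one is always a vertex-cut, so the \<open>Min\<close> ranges
  over a nonempty finite set.\<close>

lemma k_connected_iff:
  assumes "pverts G \<noteq> {}"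
  shows "k_connected k G \<longleftrightarrow> (\<forall>C. vertex_cut G C \<longrightarrow> k \<le> card C)"
proof -
  obtain w where "w \<in> pverts G" using assms by blast
  then have "pverts G - {w} \<subset> pverts G" "card (pverts G - (pverts G - {w})) = 1"
    by (auto simp: double_diff)
  then have "vertex_cut G (pverts G - {w})"
    unfolding vertex_cut_iff by blast
  moreover have "finite {C. vertex_cut G C}"
    by (rule finite_subset[of _ "Pow (pverts G)"]) (auto simp: vertex_cut_iff pair_finite_verts)
  ultimately show ?thesis
    unfolding k_connected_def vertex_connectivity_def by (subst Min_ge_iff) auto
qed

text \<open>All neighbours of a vertex of \<open>A\<close> are other vertices of \<open>A\<close> or
  lie in \<open>C\<close>. With \<open>card C = k - 1\<close> this bounds \<open>card A\<close>
  below by \<open>\<delta> - k + 2\<close>.\<close>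

lemma min_degree_less_separated:
  assumes V: "pverts G = C \<union> A \<union> B" and "A \<noteq> {}" and sep: "parcs G \<inter> A \<times> B = {}"
  shows "min_degree G < card A + card C"
proof -
  obtain u where u: "u \<in> A" using assms by blast
  have fin: "finite A" "finite C"
    using pair_finite_verts V by auto
  have "min_degree G \<le> out_degree (with_proj G) u"
    unfolding min_degree_def using pair_finite_verts u V by (intro Min_le) auto
  also have "\<dots> = card {v. (u, v) \<in> parcs G}"
    by (rule out_degree_eq_card_nbrs)
  also have "\<dots> \<le> card ((A - {u}) \<union> C)"
    using fin u sep V by (intro card_mono) (auto dest: in_arcsD2 no_loops')
  also have "\<dots> \<le> card (A - {u}) + card C"
    by (rule card_Un_le)
  also have "\<dots> < card A + card C"
    by (rule add_strict_right_mono[OF card_Diff1_less[OF fin(1) u]])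
  finally show ?thesis .
qed

text \<open>A cut of fewer than \<open>k - 1\<close> vertices is enlarged by vertices of one of the sides, which has
  enough vertices because of the minimum degree.\<close>

lemma obtain_separation:
  assumes "\<not> k_connected k G" "pverts G \<noteq> {}" "k \<le> min_degree G"
    and "min_degree G + 1 < card (pverts G)" and "0 < k"
  obtains C A B where "pverts G = C \<union> A \<union> B" "C \<inter> A = {}" "C \<inter> B = {}" "A \<inter> B = {}"
    "card C = k - 1" "A \<noteq> {}" "B \<noteq> {}" "parcs G \<inter> A \<times> B = {}" "card A \<le> card B"
proof -
  obtain C where cut: "vertex_cut G C" and C: "card C < k"
    using assms(1,2) k_connected_iff by (meson not_le_imp_less)
  have sub: "C \<subset> pverts G" and finC: "finite C"
    using cut pair_finite_verts finite_subset unfolding vertex_cut_iff by blast+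
  have "card (pverts G - C) = card (pverts G) - card C"
    using sub finC by (simp add: card_Diff_subset)
  \<comment> \<open>Fewer than \<open>k \<le> min_degree G\<close> of more than
    \<open>min_degree G + 1\<close> vertices are deleted, so at least two remain and the
    \<open>K_1\<close> kind of cut is excluded.\<close>
  then have "card (pverts G - C) \<noteq> 1"
    using C assms by linarith
  then obtain A B where AB: "A \<noteq> {}" "B \<noteq> {}" "A \<union> B = pverts G - C" "A \<inter> B = {}"
    and sep: "parcs G \<inter> A \<times> B = {}"
    using cut unfolding vertex_cut_iff by blast
  have V: "pverts G = C \<union> A \<union> B"
    using AB sub by blast
  have fin: "finite A" "finite B"
    using V pair_finite_verts by auto
  \<comment> \<open>Moving \<open>k - 1 - card C\<close> vertices from \<open>A\<close> into the cut
    thus leaves a nonempty side.\<close>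
  have "k - 1 - card C < card A"
    using min_degree_less_separated[OF V AB(1) sep] assms(3) C by linarith
  then obtain M where M: "M \<subseteq> A" "card M = k - 1 - card C"
    using obtain_subset_with_card_n by (metis less_imp_le)
  define C' A' where "C' = C \<union> M" and "A' = A - M"
  have finM: "finite M" using M(1) fin finite_subset by blast
  have "C \<inter> M = {}" using M(1) AB(3) by blast
  then have "card C' = k - 1"
    unfolding C'_def using finC finM M(2) C by (subst card_Un_disjoint) auto
  moreover have "A' \<noteq> {}"
  proof
    assume "A' = {}"
    then have "A = M" using M(1) by (auto simp: A'_def)
    with \<open>k - 1 - card C < card A\<close> M(2) show False by simp
  qed
  moreover have "pverts G = C' \<union> A' \<union> B" "C' \<inter> A' = {}" "C' \<inter> B = {}" "A' \<inter> B = {}"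
    "parcs G \<inter> A' \<times> B = {}"
    using V AB M(1) sep by (auto simp: C'_def A'_def)
  \<comment> \<open>Also with the sides exchanged, so that the smaller one can be named
    \<open>A\<close>.\<close>
  moreover have "parcs G \<inter> B \<times> A' = {}"
    using calculation(7) arcs_symmetric by blast
  moreover have "C' \<union> A' \<union> B = C' \<union> B \<union> A'" "B \<inter> A' = A' \<inter> B"
    by blast+
  ultimately show thesis
    using that[of C' A' B] that[of C' B A'] AB(2) by (metis linear)
qed

section \<open>Monotonicity of the form under adding edges\<close>

lemma signless_form_mono:
  assumes "parcs H \<subseteq> parcs G"
  shows "signless_form H x \<le> signless_form G x"
  unfolding signless_form_def using assms pair_finite_arcs
  by (intro divide_right_mono sum_mono2) auto

lemma signless_form_strict_mono:
  assumes "parcs H \<subset> parcs G" and pos: "\<And>v. v \<in> pverts G \<Longrightarrow> 0 < x v"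
  shows "signless_form H x < signless_form G x"
proof -
  obtain e where e: "e \<in> parcs G" "e \<notin> parcs H"
    using assms(1) by blast
  have "0 < x (fst e)" "0 < x (snd e)"
    using e(1) arc_fst_in_verts arc_snd_in_verts pos by auto
  then have "0 < (x (fst e) + x (snd e))\<^sup>2"
    by simp
  then have "(\<Sum>(u, v)\<in>parcs H. (x u + x v)\<^sup>2) < (\<Sum>(u, v)\<in>parcs G. (x u + x v)\<^sup>2)"
    using e assms(1) pair_finite_arcs
    by (intro sum_strict_mono2[where b = e]) (auto simp: case_prod_unfold)
  then show ?thesis
    by (simp add: signless_form_def)
qed

end

text \<open>The preimage of the joined clique is a cut of \<open>k - 1\<close> vertices;
  \<open>a\<close> and \<open>b\<close> being positive, both sides are nonempty.\<close>

lemma not_k_connected_if_iso: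
  assumes "pair_graph G" "0 < k" "0 < a" "0 < b"
    and iso: "digraph_iso (with_proj G) (with_proj (graph_join (complete_graph (k - 1))
           (graph_union (complete_graph a) (complete_graph b))))"
  shows "\<not> k_connected k G"
proof -
  interpret pair_graph G by fact
  let ?C = "Inl ` {0..<k - 1} :: (nat + nat + nat) set"
  let ?A = "Inr ` Inl ` {0..<a} :: (nat + nat + nat) set"
  let ?B = "Inr ` Inr ` {0..<b} :: (nat + nat + nat) set"
  obtain f where inj: "inj_on f (pverts G)" and verts: "f ` pverts G = ?C \<union> ?A \<union> ?B"
    and arcs: "map_prod f f ` parcs G = parcs (clique_pair ?C ?A ?B)"
    using iso unfolding digraph_iso_with_proj_iff[OF pair_wf_digraph]
      graph_join_complete_eq_clique_pair
    by (auto simp: clique_pair_def)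
  define pre where "pre S = {v \<in> pverts G. f v \<in> S}" for S
  have img: "f ` pre S = S" if "S \<subseteq> f ` pverts G" for S
    using that by (auto simp: pre_def)
  have "inj_on f (pre ?C)"
    using inj by (rule inj_on_subset) (auto simp: pre_def)
  then have "card (pre ?C) = card (f ` pre ?C)"
    by (simp add: card_image)
  also have "f ` pre ?C = ?C"
    using verts by (intro img) blast
  finally have card: "card (pre ?C) = k - 1"
    by (simp add: card_image)
  have "pre ?A \<noteq> {}" "pre ?B \<noteq> {}"
    using img[of ?A] img[of ?B] verts assms(3,4) by force+
  moreover have "pre ?A \<union> pre ?B = pverts G - pre ?C"
    using verts by (auto simp: pre_def)
  moreover have "pre ?A \<inter> pre ?B = {}"
    by (auto simp: pre_def)
  moreover have "parcs G \<inter> pre ?A \<times> pre ?B = {}"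
  proof -
    have "(f u, f v) \<in> parcs (clique_pair ?C ?A ?B)" if "(u, v) \<in> parcs G" for u v
      using map_prod_imageI[OF that, of f f] unfolding arcs .
    then show ?thesis
      by (force simp: pre_def clique_pair_def)
  qed
  moreover have "pre ?C \<subseteq> pverts G"
    by (auto simp: pre_def)
  ultimately have "vertex_cut G (pre ?C)"
    unfolding vertex_cut_iff by blast
  moreover have "pverts G \<noteq> {}"
    using \<open>pre ?A \<noteq> {}\<close> by (auto simp: pre_def)
  ultimately show ?thesis
    using k_connected_iff card assms(2) by (metis diff_less less_numeral_extra(1) not_le)
qed

section \<open>Comparison of \<open>G\<close> with the extremal graph\<close>

theorem theorem4p1:
  fixes G :: "'a pair_pre_digraph" and n \<delta> k :: nat
  assumes "pair_graph G" and "Digraph_Component.connected (with_proj G)"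
    and "card (pverts G) = n" and "min_degree G = \<delta>"
    and "\<delta> \<ge> k" and "k \<ge> 2"
    and "n - \<delta> - 1 \<ge> 1"
    and "Q_index G \<ge> Q_index (graph_join (complete_graph (k - 1))
           (graph_union (complete_graph (\<delta> - k + 2)) (complete_graph (n - \<delta> - 1))))"
  shows "k_connected k G \<longleftrightarrow>
    \<not> digraph_iso (with_proj G) (with_proj (graph_join (complete_graph (k - 1))
           (graph_union (complete_graph (\<delta> - k + 2)) (complete_graph (n - \<delta> - 1)))))"
proof -
  let ?J = "graph_join (complete_graph (k - 1))
    (graph_union (complete_graph (\<delta> - k + 2)) (complete_graph (n - \<delta> - 1)))"
  interpret pair_graph G by fact
  define m where "m = \<delta> - k + 2"
  have pair_J: "pair_graph ?J"
    by (intro pair_graph_graph_join pair_graph_graph_union pair_graph_complete_graph)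
  have "digraph_iso (with_proj G) (with_proj ?J)" if not_conn: "\<not> k_connected k G"
  proof -
    have "pverts G \<noteq> {}"
      using assms by auto
    \<comment> \<open>With truncated subtraction, \<open>n - \<delta> - 1 \<ge> 1\<close> says
      \<open>\<delta> + 1 < n\<close>.\<close>
    moreover have "k \<le> min_degree G" "min_degree G + 1 < card (pverts G)" "0 < k"
      using assms by linarith+
    ultimately obtain C A B where V: "pverts G = C \<union> A \<union> B"
      and disj: "C \<inter> A = {}" "C \<inter> B = {}" "A \<inter> B = {}" and C: "card C = k - 1"
      and AB: "A \<noteq> {}" "B \<noteq> {}" and sep: "parcs G \<inter> A \<times> B = {}" and le: "card A \<le> card B"
      by (rule obtain_separation[OF not_conn])
    have fin: "finite C" "finite A" "finite B"
      using V pair_finite_verts by auto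
    have n: "n = card C + card A + card B"
      using assms(3) fin disj unfolding V by (simp add: card_Un_disjoint Int_Un_distrib2)
    have "m \<le> card A"
      using min_degree_less_separated[OF V AB(1) sep] C assms by (simp add: m_def)
    have sub: "parcs G \<subseteq> parcs (clique_pair C A B)"
    proof
      fix e assume "e \<in> parcs G"
      then obtain u v where e: "e = (u, v)" and uv: "(u, v) \<in> parcs G" "(v, u) \<in> parcs G"
        using arcs_symmetric by (cases e) auto
      have "u \<in> C \<union> A \<union> B" "v \<in> C \<union> A \<union> B" "u \<noteq> v"
        using uv(1) in_arcsD1 in_arcsD2 no_loops' V by auto
      moreover have "(u, v) \<notin> A \<times> B" "(u, v) \<notin> B \<times> A"
        using uv sep by auto
      ultimately show "e \<in> parcs (clique_pair C A B)"
        by (simp add: e clique_pair_def)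
    qed
    have iso_J: "digraph_iso (with_proj (clique_pair C A' B')) (with_proj ?J)"
      if "A' \<union> B' = A \<union> B" "A' \<inter> B' = {}" "card A' = m" for A' B'
    proof -
      have fin': "finite A'" "finite B'"
        using finite_UnI[OF fin(2,3)] unfolding that(1)[symmetric] by simp_all
      have disj': "C \<inter> A' = {}" "C \<inter> B' = {}"
        using that(1) disj by blast+
      have "card A' + card B' = card A + card B"
        using that(1,2) fin fin' disj(3) by (simp flip: card_Un_disjoint)
      \<comment> \<open>\<open>C\<close> and \<open>A'\<close> together have
        \<open>(k - 1) + (\<delta> - k + 2) = \<delta> + 1\<close> vertices;
        \<open>k \<le> \<delta>\<close> keeps the subtraction exact.\<close>
      then have "card B' = n - \<delta> - 1"
        using n that(3) C assms(5,6) unfolding m_def by arith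
      then show ?thesis
        using digraph_iso_clique_pair[OF fin(1) fin' disj' that(2)] C that(3) by (simp add: m_def)
    qed
    obtain x where pos: "\<And>v. v \<in> pverts G \<Longrightarrow> 0 < x v" and norm: "(\<Sum>v\<in>pverts G. (x v)\<^sup>2) = 1"
      and form: "signless_form G x = Q_index G"
      using Perron_function[OF assms(2)] by metis
    \<comment> \<open>The unit function \<open>x\<close> bounds the form of the copy by its
      \<open>Q\<close>-index, which is at most that of \<open>G\<close>, the value of the form of
      \<open>G\<close> at \<open>x\<close>.\<close>
    have bound: "signless_form (clique_pair C A' B') x \<le> signless_form G x"
      if "A' \<union> B' = A \<union> B" "A' \<inter> B' = {}" "card A' = m" for A' B'
    proof -
      have "finite A'" "finite B'"
        using finite_UnI[OF fin(2,3)] unfolding that(1)[symmetric] by simp_all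
      with fin interpret K: pair_graph "clique_pair C A' B'"
        by (intro pair_graph_clique_pair)
      have "pverts (clique_pair C A' B') = pverts G"
        using that(1) V by (auto simp: clique_pair_def)
      then have "signless_form (clique_pair C A' B') x \<le> Q_index (clique_pair C A' B')"
        using K.signless_form_le_Q_index[of x] norm by simp
      also have "\<dots> = Q_index ?J"
        by (rule Q_index_iso[OF K.pair_graph pair_J iso_J[OF that]])
      finally show ?thesis
        using assms(8) form by simp
    qed
    interpret K: pair_graph "clique_pair C A B"
      using fin by (rule pair_graph_clique_pair)
    \<comment> \<open>Otherwise shrinking the smaller side to \<open>m\<close> vertices lifts the
      form strictly above its value for \<open>G\<close>, against \<open>bound\<close>.\<close>
    have "card A = m"
    proof (rule ccontr)
      assume "card A \<noteq> m"
      with \<open>m \<le> card A\<close> have "m < card A" by simp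
      moreover have "0 < x v" if "v \<in> A \<union> B" for v
        using that pos V by blast
      ultimately obtain A' B' where "A' \<union> B' = A \<union> B" "A' \<inter> B' = {}" "card A' = m"
        and "signless_form (clique_pair C A B) x < signless_form (clique_pair C A' B') x"
        by (rule signless_form_shrink_clique[OF fin disj(3) _ le])
      then show False
        using bound[of A' B'] K.signless_form_mono[OF sub, of x] by linarith
    qed
    \<comment> \<open>Now \<open>clique_pair C A B\<close> is itself a copy of the extremal graph;
      an arc missing from \<open>G\<close> would make the form of \<open>G\<close> strictly smaller
      at the positive \<open>x\<close>.\<close>
    have "parcs G = parcs (clique_pair C A B)"
    proof (rule ccontr)
      assume "parcs G \<noteq> parcs (clique_pair C A B)"
      then have "signless_form G x < signless_form (clique_pair C A B) x"
        using sub pos V by (intro K.signless_form_strict_mono) (auto simp: clique_pair_def)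
      then show False
        using bound[OF refl disj(3) \<open>card A = m\<close>] by simp
    qed
    then have "G = clique_pair C A B"
      using V by (simp add: clique_pair_def)
    then show ?thesis
      using iso_J[OF refl disj(3) \<open>card A = m\<close>] by simp
  qed
  moreover have "\<not> k_connected k G" if "digraph_iso (with_proj G) (with_proj ?J)"
    using that assms by (intro not_k_connected_if_iso[of G k "\<delta> - k + 2" "n - \<delta> - 1"]) auto
  ultimately show ?thesis by blast
qed

end
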